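(* Let $\alpha>0$, $1\le p,q\le\infty$ and $\gamma\in(0,1)$. Given a path $\omega:[a,b]\to\mathbb{R}^d$, if the occupation measure $(\mu^\omega_{a,t})_{t\in[a,b]}$ is $\gamma$-Hölder continuous with values in $\mathrm{SBE}^{\alpha,p}_q$ (that is, there is $C$ with $\|\mu^\omega_{a,t}-\mu^\omega_{a,s}\|_{\mathrm{SBE}^{\alpha,p}_q}\le C|t-s|^\gamma$ for all $s,t\in[a,b]$), then $\omega$ is $(\alpha,\gamma)$-irregular.
   Context: The occupation measure of $\omega$ is $\mu^\omega_{s,t}=\int_s^t\delta_{\omega_r}\,dr$, i.e. $\mu^\omega_{s,t}(A)=\mathrm{Leb}\{r\in[s,t]:\omega_r\in A\}$; here it is compactly supported. A path $\omega:[a,b]\to\mathbb{R}^d$ is $(\rho,\gamma)$-irregular if there is $K<\infty$ such that $\big|\int_s^te^{i\xi\cdot\omega_r}\,dr\big|\le K(1+|\xi|)^{-\rho}|t-s|^\gamma$ for all $\xi\in\mathbb{R}^d$ and $a\le s\le t\le b$. $\mathbb{R}^+=(0,\infty)$. For a finite measure $\mu$ on $\mathbb{R}^d$ set $F_\mu(r,y)=\mu(\{x\in\mathbb{R}^d:|x-y|\le r\})$. For a function $F$ of $r$ define recursively $\Delta_0F(r)=F(r)-F(r/2)$, $\Delta_{k+1}F(r)=\Delta_kF(r)-2^{k+1}\Delta_kF(r/2)$. For $\alpha>0$, $1\le p,q\le\infty$ and $k=\lceil\alpha+d-1\rceil$, set $$\|\mu\|_{\mathrm{SBE}^{\alpha,p}_q}=\big\|r^{-\alpha-d}(\Delta_k)_rF_\mu(r,y)\big\|_{L^q_yL^p_r(\mathbb{R}^d\times\mathbb{R}^+,\,dy\otimes\frac{dr}{r})},$$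 where $(\Delta_k)_r$ acts in $r$, the $L^p$ norm in $r$ (w.r.t. $dr/r$) is taken first and then the $L^q$ norm in $y$. A compactly supported finite measure is in $\mathrm{SBE}^{\alpha,p}_q$ if this quantity is finite. *)

theory Defs
  imports "HOL-Analysis.Analysis" "HOL-Probability.Essential_Supremum"
begin

text \<open>Real powers on \<open>[0,\<infinity>]\<close>; only positive exponents are used below.\<close>

definition ennreal_powr :: "ennreal \<Rightarrow> real \<Rightarrow> ennreal" where
  "ennreal_powr x a = (if x = top then top else ennreal (enn2real x powr a))"

definition Lp_norm :: "ennreal \<Rightarrow> 'b measure \<Rightarrow> ('b \<Rightarrow> ennreal) \<Rightarrow> ennreal" where
  "Lp_norm p M f =
     (if p = top then esssup M f
      else ennreal_powr (\<integral>\<^sup>+ x. ennreal_powr (f x) (enn2real p) \<partial>M) (1 / enn2real p))"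

definition dr_over_r :: "real measure" where
  "dr_over_r = density (restrict_space lborel {0<..}) (\<lambda>r. ennreal (1 / r))"

primrec Delta :: "nat \<Rightarrow> (real \<Rightarrow> real) \<Rightarrow> real \<Rightarrow> real" where
  "Delta 0 F r = F r - F (r / 2)"
| "Delta (Suc k) F r = Delta k F r - 2 ^ (k + 1) * Delta k F (r / 2)"

text \<open>
  The norm is defined on real-valued set functions, so that it applies both to a finite
  measure \<open>M\<close> (through \<open>measure M\<close>) and to a difference of two finite measures.
  Here \<open>\<nu> (cball y r)\<close> is \<open>F(r,y)\<close>.
\<close>

definition SBE_norm ::
  "real \<Rightarrow> ennreal \<Rightarrow> ennreal \<Rightarrow> ('a::euclidean_space set \<Rightarrow> real) \<Rightarrow> ennreal" where
  "SBE_norm \<alpha> p q \<nu> =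
     (let d = real DIM('a); k = nat \<lceil>\<alpha> + d - 1\<rceil> in
      Lp_norm q lborel (\<lambda>y::'a.
        Lp_norm p dr_over_r (\<lambda>r.
          ennreal \<bar>r powr (- \<alpha> - d) * Delta k (\<lambda>\<rho>. \<nu> (cball y \<rho>)) r\<bar>)))"

definition in_SBE ::
  "real \<Rightarrow> ennreal \<Rightarrow> ennreal \<Rightarrow> 'a::euclidean_space measure \<Rightarrow> bool" where
  "in_SBE \<alpha> p q \<mu> \<longleftrightarrow>
     sets \<mu> = sets borel \<and> finite_measure \<mu> \<and>
     (\<exists>K. compact K \<and> emeasure \<mu> (- K) = 0) \<and>
     SBE_norm \<alpha> p q (measure \<mu>) < top"

definition holder_in_SBE ::
  "real \<Rightarrow> ennreal \<Rightarrow> ennreal \<Rightarrow> real \<Rightarrow> real \<Rightarrow> real \<Rightarrow> (real \<Rightarrow> 'a::euclidean_space measure) \<Rightarrow> bool"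
  where
  "holder_in_SBE \<alpha> p q \<gamma> a b \<mu> \<longleftrightarrow>
     (\<forall>t\<in>{a..b}. in_SBE \<alpha> p q (\<mu> t)) \<and>
     (\<exists>C\<ge>0. \<forall>s\<in>{a..b}. \<forall>t\<in>{a..b}.
        SBE_norm \<alpha> p q (\<lambda>A. measure (\<mu> t) A - measure (\<mu> s) A)
          \<le> ennreal (C * \<bar>t - s\<bar> powr \<gamma>))"

definition occupation_measure ::
  "(real \<Rightarrow> 'a::euclidean_space) \<Rightarrow> real \<Rightarrow> real \<Rightarrow> 'a measure" where
  "occupation_measure \<omega> s t = distr (lebesgue_on {s..t}) borel \<omega>"

definition irregular ::
  "real \<Rightarrow> real \<Rightarrow> real \<Rightarrow> real \<Rightarrow> (real \<Rightarrow> 'a::euclidean_space) \<Rightarrow> bool" where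
  "irregular \<rho> \<gamma> a b \<omega> \<longleftrightarrow>
     (\<exists>K. \<forall>\<xi> s t. a \<le> s \<and> s \<le> t \<and> t \<le> b \<longrightarrow>
        norm (LINT r|lebesgue_on {s..t}. exp (\<i> * complex_of_real (\<xi> \<bullet> \<omega> r)))
          \<le> K * (1 + norm \<xi>) powr (- \<rho>) * \<bar>t - s\<bar> powr \<gamma>)"

end

theory Submission
  imports Defs
begin

text \<open>
  The SBE norm of a measure controls its Fourier transform at high frequencies. Let \<open>\<nu>\<close> be the
  occupation measure of \<open>[s,t]\<close>, a finite measure supported in a fixed ball, with Fourier transform
  \<open>\<nu>\<^sub>F \<xi> = \<integral> exp (\<i> \<xi> \<bullet> x) d\<nu>\<close>. The function \<open>y \<mapsto> \<nu> (cball y r)\<close> is the convolution of \<open>\<nu>\<close>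
  with the indicator of a ball, so Fourier transforming its dyadic difference in \<open>y\<close> gives the product
  of \<open>\<nu>\<^sub>F \<xi>\<close> and an explicit function of \<open>r\<close> and \<open>\<xi>\<close>, called \<open>shell_multiplier\<close> below. Putting
  absolute values inside the integral yields, for every single radius,
  \<open>\<bar>\<nu>\<^sub>F \<xi>\<bar> \<bar>shell_multiplier k r \<xi>\<bar> \<le> \<integral> \<bar>Delta k (\<nu> (cball y \<cdot>)) r\<bar> dy\<close>
  (\<open>Fourier_times_shell_multiplier_le\<close>).

  Fix \<open>\<bar>\<xi>\<bar> \<ge> 1\<close>, multiply by \<open>r powr (-\<alpha>-d-1)\<close> and integrate over the radii
  \<open>c/\<bar>\<xi>\<bar> \<le> r \<le> C/\<bar>\<xi>\<bar>\<close>. On the right, only \<open>y\<close> in a fixed ball contribute, and the window has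
  \<open>dr/r\<close>-mass bounded independently of \<open>\<xi>\<close>; on sets of finite measure an integral is dominated by any
  \<open>L\<^sup>p\<close> norm, so the right-hand side is at most a constant times the SBE norm of \<open>\<nu>\<close>, whatever \<open>p\<close> and
  \<open>q\<close> are. On the left, the multiplier is homogeneous, and rescaling \<open>r = u/\<bar>\<xi>\<bar>\<close> produces
  \<open>\<bar>\<nu>\<^sub>F \<xi>\<bar> \<bar>\<xi>\<bar> powr \<alpha>\<close> times the integral over \<open>c \<le> u \<le> C\<close> of a weight times the multiplier in the
  direction \<open>\<xi>/\<bar>\<xi>\<bar>\<close> (\<open>Fourier_le_SBE_norm\<close>). Decay of order \<open>\<alpha>\<close> follows as soon as this last integral
  is bounded below uniformly over all directions.

  The lower bound (\<open>shell_multiplier_integral_bounded_below\<close>) is a compactness argument over the unit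
  sphere, once it is known that in no direction \<open>e\<close> the multiplier vanishes for all radii. This is where
  the structure of the dyadic differences matters. If it did vanish, then
  \<open>h r = r^d * unit_ball_ft (r e)\<close> would be annihilated by \<open>Delta k\<close>, a product of the operators
  \<open>h \<mapsto> (h r - 2^j h (r/2))\<close> for \<open>j \<le> k\<close>. Each factor is injective on functions that are \<open>O(r^d)\<close>
  everywhere and \<open>o(r^d)\<close> at \<open>0\<close> (\<open>Delta_injective\<close>), and, applied to \<open>h\<close> minus its leading
  term at \<open>0\<close>, this forces \<open>h\<close> to be a multiple of \<open>r^d\<close>, that is,
  \<open>unit_ball_ft\<close> to be constant along the ray. But \<open>unit_ball_ft \<eta>\<close> is strictly smaller than the
  volume of the ball for \<open>\<eta> \<noteq> 0\<close>.

  For \<open>\<bar>\<xi>\<bar> < 1\<close> the trivial bound \<open>\<bar>\<nu>\<^sub>F \<xi>\<bar> \<le> t - s\<close> is enough, because \<open>\<gamma> < 1\<close> and \<open>[a,b]\<close> is bounded.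
\<close>

section \<open>Injectivity of the dyadic differences\<close>

text \<open>
  As a fixed linear combination of dilates, \<open>Delta k F\<close> inherits continuity, measurability and
  homogeneity from \<open>F\<close>, and commutes with integration in a parameter.
\<close>

lemma Delta_eq_sum:
  obtains a :: "nat \<Rightarrow> real"
  where "\<And>F r. Delta k F r = (\<Sum>i\<le>Suc k. a i * F (r / 2 ^ i))"
proof -
  have "\<exists>a. \<forall>F r. Delta k F r = (\<Sum>i\<le>Suc k. a i * F (r / 2 ^ i))"
  proof (induction k)
    case 0
    show ?case
      by (rule exI[of _ "\<lambda>i. if i = 0 then 1 else -1"]) auto
  next
    case (Suc k)
    then obtain a where a: "\<And>F r. Delta k F r = (\<Sum>i\<le>Suc k. a i * F (r / 2 ^ i))"
      by blast
    define c :: real where "c = 2 ^ (k + 1)"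
    define a' where
      "a' i = (if i \<le> Suc k then a i else 0) - c * (if i = 0 then 0 else a (i - 1))" for i
    have "Delta (Suc k) F r = (\<Sum>i\<le>Suc (Suc k). a' i * F (r / 2 ^ i))" for F r
    proof -
      have "Delta k F r = (\<Sum>i\<le>Suc (Suc k). (if i \<le> Suc k then a i else 0) * F (r / 2 ^ i))"
        unfolding a by (subst sum.atMost_Suc[of _ "Suc k"]) (auto intro!: sum.cong)
      moreover have "Delta k F (r / 2) =
          (\<Sum>i\<le>Suc (Suc k). (if i = 0 then 0 else a (i - 1)) * F (r / 2 ^ i))"
        unfolding a by (subst sum.atMost_Suc_shift[of _ "Suc k"]) (auto intro!: sum.cong)
      ultimately show ?thesis
        by (simp add: a'_def c_def left_diff_distrib sum_subtractf sum_distrib_left mult.assoc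
            del: sum.atMost_Suc)
    qed
    then show ?case by blast
  qed
  then show ?thesis using that by blast
qed

lemma Delta_diff: "Delta k (\<lambda>r. f r - g r) r = Delta k f r - Delta k g r"
  by (induction k arbitrary: r) (simp_all add: right_diff_distrib)

lemma Delta_power:
  "Delta k (\<lambda>r. c * r ^ n) r = (\<Prod>j\<le>k. 1 - 2 ^ j / 2 ^ n) * (c * r ^ n)"
  by (induction k arbitrary: r) (simp_all add: field_simps)

text \<open>
  A class on which \<open>Delta k\<close> is injective. The functions annihilated by a factor of \<open>Delta k\<close> behave
  like \<open>r ^ j\<close>, up to a factor periodic in the logarithm of \<open>r\<close>. For \<open>j \<noteq> n\<close> the global bound excludes
  them, at \<open>0\<close> or at infinity; for \<open>j = n\<close> the limit at \<open>0\<close> does.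
\<close>

definition vanishing_beyond_power :: "nat \<Rightarrow> (real \<Rightarrow> real) \<Rightarrow> bool" where
  "vanishing_beyond_power n f \<longleftrightarrow>
     (\<exists>M. \<forall>r>0. \<bar>f r\<bar> \<le> M * r ^ n) \<and> ((\<lambda>r. f r / r ^ n) \<longlongrightarrow> 0) (at_right 0)"

lemma filterlim_divide_at_right_0:
  fixes c :: real
  assumes "c > 0"
  shows "filterlim (\<lambda>r. r / c) (at_right 0) (at_right 0)"
proof -
  have "((\<lambda>r. r / c) \<longlongrightarrow> 0 / c) (at_right 0)" by (intro tendsto_intros) (use assms in auto)
  moreover have "eventually (\<lambda>r::real. r > 0) (at_right 0)"
    by (rule eventually_at_right_less)
  ultimately show ?thesis
    using assms by (auto simp: filterlim_at elim: eventually_mono)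
qed

lemma vanishing_beyond_power_dilation_diff:
  assumes "vanishing_beyond_power n f"
  shows "vanishing_beyond_power n (\<lambda>r. f r - c * f (r / 2))"
proof -
  obtain M where M: "\<And>r. r > 0 \<Longrightarrow> \<bar>f r\<bar> \<le> M * r ^ n"
    and lim: "((\<lambda>r. f r / r ^ n) \<longlongrightarrow> 0) (at_right 0)"
    using assms unfolding vanishing_beyond_power_def by blast
  have "\<bar>f r - c * f (r / 2)\<bar> \<le> (M + \<bar>c\<bar> * (M / 2 ^ n)) * r ^ n" if "r > 0" for r
  proof -
    have "\<bar>f r - c * f (r / 2)\<bar> \<le> \<bar>f r\<bar> + \<bar>c\<bar> * \<bar>f (r / 2)\<bar>"
      by (metis abs_mult abs_triangle_ineq4)
    also have "\<dots> \<le> M * r ^ n + \<bar>c\<bar> * (M * (r / 2) ^ n)"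
      using M[of r] M[of "r / 2"] that by (intro add_mono mult_left_mono) auto
    finally show ?thesis by (simp add: field_simps)
  qed
  moreover have "((\<lambda>r. f r / r ^ n - c / 2 ^ n * (f (r / 2) / (r / 2) ^ n)) \<longlongrightarrow> 0 - c / 2 ^ n * 0)
      (at_right 0)"
    by (intro tendsto_intros lim filterlim_compose[OF lim filterlim_divide_at_right_0]) auto
  then have "((\<lambda>r. (f r - c * f (r / 2)) / r ^ n) \<longlongrightarrow> 0) (at_right 0)"
    by (simp add: power_divide diff_divide_distrib)
  ultimately show ?thesis
    unfolding vanishing_beyond_power_def by blast
qed

lemma vanishing_beyond_power_Delta:
  assumes "vanishing_beyond_power n f"
  shows "vanishing_beyond_power n (Delta k f)"
proof (induction k)
  case 0
  then show ?case using vanishing_beyond_power_dilation_diff[OF assms, of 1] by simp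
next
  case (Suc k)
  then show ?case using vanishing_beyond_power_dilation_diff[OF Suc, of "2 ^ (k + 1)"] by simp
qed

text \<open>
  Iterating the equation relates \<open>f r\<close> to the values \<open>f (r / 2 ^ m)\<close>, respectively \<open>f (r * 2 ^ m)\<close>.
  For \<open>j \<le> n\<close> going down to \<open>0\<close> gains the vanishing of \<open>f r / r ^ n\<close>; for \<open>j > n\<close> going up to
  infinity makes \<open>f\<close> grow faster than \<open>r ^ n\<close> unless it is zero.
\<close>

lemma dilation_eigenfunction_eq_0:
  assumes f: "vanishing_beyond_power n f"
    and eig: "\<And>r. r > 0 \<Longrightarrow> f r = 2 ^ j * f (r / 2)"
    and "r > 0"
  shows "f r = 0"
proof -
  obtain M where M: "\<And>r. r > 0 \<Longrightarrow> \<bar>f r\<bar> \<le> M * r ^ n"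
    and lim: "((\<lambda>r. f r / r ^ n) \<longlongrightarrow> 0) (at_right 0)"
    using f unfolding vanishing_beyond_power_def by blast
  have iter: "f r = (2 ^ j) ^ m * f (r / 2 ^ m)" if "r > 0" for r m
  proof (induction m)
    case (Suc m)
    then show ?case using eig[of "r / 2 ^ m"] that by (simp add: field_simps)
  qed simp
  show ?thesis
  proof (cases "j \<le> n")
    case True
    have "(\<lambda>m. r / 2 ^ m) \<longlonglongrightarrow> 0"
      by real_asymp
    then have "filterlim (\<lambda>m. r / 2 ^ m) (at_right 0) sequentially"
      using \<open>r > 0\<close> by (auto simp: filterlim_at)
    then have "(\<lambda>m. f (r / 2 ^ m) / (r / 2 ^ m) ^ n) \<longlonglongrightarrow> 0"
      by (rule filterlim_compose[OF lim])
    then have "(\<lambda>m. r ^ n * \<bar>f (r / 2 ^ m) / (r / 2 ^ m) ^ n\<bar>) \<longlonglongrightarrow> 0"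
      by (intro tendsto_mult_right_zero tendsto_rabs_zero)
    moreover have "\<bar>f r\<bar> \<le> r ^ n * \<bar>f (r / 2 ^ m) / (r / 2 ^ m) ^ n\<bar>" for m
    proof -
      have "(2 ^ j) ^ m \<le> ((2 ^ n) ^ m :: real)"
        using True by (intro power_mono power_increasing) auto
      then have "(2 ^ j) ^ m * \<bar>f (r / 2 ^ m)\<bar> \<le> (2 ^ n) ^ m * \<bar>f (r / 2 ^ m)\<bar>"
        by (intro mult_right_mono) auto
      also have "\<dots> = r ^ n * \<bar>f (r / 2 ^ m) / (r / 2 ^ m) ^ n\<bar>"
        using \<open>r > 0\<close> by (simp add: power_divide abs_mult mult.commute flip: power_mult)
      finally show ?thesis
        using iter[OF \<open>r > 0\<close>, of m] by (simp add: abs_mult)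
    qed
    ultimately have "\<bar>f r\<bar> \<le> 0"
      by (intro LIMSEQ_le_const) auto
    then show ?thesis by simp
  next
    case False
    have "\<bar>f r\<bar> \<le> M * r ^ n * (1 / 2) ^ m" for m
    proof -
      have M0: "M * r ^ n \<ge> 0" using M[OF \<open>r > 0\<close>] by linarith
      have "(2 ^ j) ^ m * \<bar>f r\<bar> = \<bar>f (r * 2 ^ m)\<bar>"
        using iter[of "r * 2 ^ m" m] \<open>r > 0\<close> by (simp add: abs_mult)
      also have "\<dots> \<le> M * (r * 2 ^ m) ^ n"
        using M[of "r * 2 ^ m"] \<open>r > 0\<close> by simp
      also have "\<dots> = M * r ^ n * (1 / 2) ^ m * (2 ^ Suc n) ^ m"
        by (simp add: power_mult_distrib power_divide flip: power_mult)
      also have "\<dots> \<le> M * r ^ n * (1 / 2) ^ m * (2 ^ j) ^ m"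
        using False M0 by (intro mult_left_mono power_mono power_increasing) auto
      finally show ?thesis by simp
    qed
    moreover have "(\<lambda>m. M * r ^ n * (1 / 2) ^ m) \<longlonglongrightarrow> 0"
      by (intro tendsto_mult_right_zero LIMSEQ_realpow_zero) auto
    ultimately have "\<bar>f r\<bar> \<le> 0"
      by (intro LIMSEQ_le_const) auto
    then show ?thesis by simp
  qed
qed

text \<open>
  Each stage of the recursion of \<open>Delta\<close> says that the previous one is a dilation eigenfunction, and
  the previous one stays in the class, so the differences can be stripped off one by one.
\<close>

lemma Delta_injective:
  assumes "vanishing_beyond_power n f" and "\<And>r. r > 0 \<Longrightarrow> Delta k f r = 0" and "r > 0"
  shows "f r = 0"
  using assms(2,3)
proof (induction k arbitrary: r)
  case 0
  have "f r = 2 ^ 0 * f (r / 2)" if "r > 0" for r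
    using "0.prems"(1)[OF that] by simp
  then show ?case
    using dilation_eigenfunction_eq_0[OF assms(1)] "0.prems"(2) by blast
next
  case (Suc k)
  have "Delta k f r = 2 ^ (k + 1) * Delta k f (r / 2)" if "r > 0" for r
    using Suc.prems(1)[OF that] by simp
  then have "Delta k f r = 0" if "r > 0" for r
    using dilation_eigenfunction_eq_0[OF vanishing_beyond_power_Delta[OF assms(1)]] that by blast
  then show ?case using Suc by blast
qed

text \<open>
  Subtracting \<open>L * \<rho> ^ n\<close> puts the function into the class where \<open>Delta k\<close> is injective. The
  subtracted term contributes only a multiple of \<open>r ^ n\<close>, and the behaviour at \<open>0\<close> shows that this
  multiple is zero; so a vanishing difference would make \<open>\<phi>\<close> equal to its limit everywhere.
\<close>

lemma Delta_homogeneous_ne_0: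
  fixes \<phi> :: "real \<Rightarrow> real"
  assumes bdd: "\<And>r. r > 0 \<Longrightarrow> \<bar>\<phi> r\<bar> \<le> M"
    and lim: "(\<phi> \<longlongrightarrow> L) (at_right 0)"
    and nonconst: "u > 0" "\<phi> u \<noteq> L"
  shows "\<exists>r>0. Delta k (\<lambda>\<rho>. \<rho> ^ n * \<phi> \<rho>) r \<noteq> 0"
proof (rule ccontr)
  assume "\<not> ?thesis"
  then have zero: "\<And>r. r > 0 \<Longrightarrow> Delta k (\<lambda>\<rho>. \<rho> ^ n * \<phi> \<rho>) r = 0" by auto
  define f where "f = (\<lambda>\<rho>. \<rho> ^ n * \<phi> \<rho> - L * \<rho> ^ n)"
  define C where "C = (\<Prod>j\<le>k. 1 - 2 ^ j / 2 ^ n :: real) * L"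
  have "vanishing_beyond_power n f"
    unfolding vanishing_beyond_power_def
  proof (intro conjI exI allI impI)
    fix r :: real assume "r > 0"
    have "\<bar>f r\<bar> = r ^ n * \<bar>\<phi> r - L\<bar>"
    proof -
      have "f r = r ^ n * (\<phi> r - L)" by (simp add: f_def algebra_simps)
      then show ?thesis using \<open>r > 0\<close> by (simp add: abs_mult)
    qed
    also have "\<dots> \<le> r ^ n * (M + \<bar>L\<bar>)"
      using bdd[OF \<open>r > 0\<close>] \<open>r > 0\<close> by (intro mult_left_mono) auto
    finally show "\<bar>f r\<bar> \<le> (M + \<bar>L\<bar>) * r ^ n" by (simp add: mult.commute)
  next
    have "((\<lambda>r. \<phi> r - L) \<longlongrightarrow> L - L) (at_right 0)"
      by (intro tendsto_intros lim)
    moreover have "eventually (\<lambda>r. \<phi> r - L = f r / r ^ n) (at_right 0)"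
      using eventually_at_right_less[of "0::real"]
      by eventually_elim (simp add: f_def field_simps)
    ultimately show "((\<lambda>r. f r / r ^ n) \<longlongrightarrow> 0) (at_right 0)"
      by (simp add: tendsto_cong)
  qed
  note f = this
  \<comment> \<open>The limit at \<open>0\<close> will force \<open>C = 0\<close>, whether because \<open>L = 0\<close> or because \<open>n \<le> k\<close>.\<close>
  have Df: "Delta k f r = - C * r ^ n" if "r > 0" for r
    unfolding f_def Delta_diff Delta_power using zero[OF that] by (simp add: C_def)
  have "((\<lambda>r. Delta k f r / r ^ n) \<longlongrightarrow> 0) (at_right 0)"
    using vanishing_beyond_power_Delta[OF f] unfolding vanishing_beyond_power_def by blast
  moreover have "eventually (\<lambda>r. Delta k f r / r ^ n = - C) (at_right 0)"
    using eventually_at_right_less[of "0::real"]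
    by eventually_elim (simp add: Df)
  ultimately have "((\<lambda>r::real. - C) \<longlongrightarrow> 0) (at_right 0)"
    by (simp add: tendsto_cong)
  then have "C = 0" by (simp add: tendsto_const_iff)
  then have "f u = 0"
    using Delta_injective[OF f _ nonconst(1), of k] Df by simp
  then show False using nonconst by (simp add: f_def)
qed

section \<open>The Fourier transform of the ball\<close>

text \<open>
  The cosine suffices for the Fourier transform of the indicator of the unit ball, since the ball is
  symmetric and the sine part integrates to zero.
\<close>

definition unit_ball_ft :: "'a::euclidean_space \<Rightarrow> real" where
  "unit_ball_ft \<eta> = (LINT z:cball 0 1|lborel. cos (\<eta> \<bullet> z))"

lemma set_integrable_cball:
  fixes f :: "'a::euclidean_space \<Rightarrow> 'b::{banach, second_countable_topology}"
  assumes [measurable]: "f \<in> borel_measurable borel" and "\<And>z. norm (f z) \<le> B"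
  shows "set_integrable lborel (cball y r) f"
  unfolding set_integrable_def
  by (rule integrableI_bounded_set_indicator[where B = B])
     (use assms emeasure_lborel_cball_finite in auto)

lemma unit_ball_ft_0: "unit_ball_ft (0::'a::euclidean_space) = measure lborel (cball (0::'a) 1)"
  unfolding unit_ball_ft_def set_lebesgue_integral_def by simp

lemma abs_unit_ball_ft_le:
  "\<bar>unit_ball_ft (\<eta>::'a::euclidean_space)\<bar> \<le> measure lborel (cball (0::'a) 1)"
proof -
  have "\<bar>unit_ball_ft \<eta>\<bar> \<le> (LINT z:cball (0::'a) 1|lborel. norm (cos (\<eta> \<bullet> z)))"
    unfolding unit_ball_ft_def set_lebesgue_integral_def
    using integral_norm_bound[of lborel "\<lambda>z. indicator (cball (0::'a) 1) z *\<^sub>R cos (\<eta> \<bullet> z)"]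
    by (simp add: abs_mult)
  also have "\<dots> \<le> (LINT z:cball (0::'a) 1|lborel. 1)"
    by (intro set_integral_mono set_integrable_cball[where B = 1]) auto
  finally show ?thesis by (simp add: set_lebesgue_integral_def)
qed

lemma continuous_on_unit_ball_ft:
  "continuous_on A (unit_ball_ft :: 'a::euclidean_space \<Rightarrow> real)"
proof -
  have "isCont unit_ball_ft \<eta>" for \<eta> :: 'a
    unfolding continuous_at_sequentially
  proof (intro allI impI)
    fix X :: "nat \<Rightarrow> 'a" assume X: "X \<longlonglongrightarrow> \<eta>"
    show "(unit_ball_ft \<circ> X) \<longlonglongrightarrow> unit_ball_ft \<eta>"
      unfolding o_def unit_ball_ft_def set_lebesgue_integral_def
    proof (rule integral_dominated_convergence[where w = "indicator (cball 0 1)"])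
      show "integrable lborel (indicator (cball 0 1) :: 'a \<Rightarrow> real)"
        using emeasure_lborel_cball_finite by (intro integrable_real_indicator) auto
    qed (auto intro!: tendsto_intros X simp: indicator_def)
  qed
  then show ?thesis by (simp add: continuous_at_imp_continuous_on)
qed

text \<open>
  Equality would force \<open>cos (\<eta> \<bullet> z) = 1\<close> for almost all \<open>z\<close> in the ball, but the inequality holds on
  a nonempty open set, close to the origin in the direction \<open>\<eta>\<close>.
\<close>

lemma unit_ball_ft_ne_volume:
  fixes \<eta> :: "'a::euclidean_space"
  assumes "\<eta> \<noteq> 0"
  shows "unit_ball_ft \<eta> \<noteq> measure lborel (cball (0::'a) 1)"
proof
  assume eq: "unit_ball_ft \<eta> = measure lborel (cball (0::'a) 1)"
  let ?f = "\<lambda>z. indicator (cball (0::'a) 1) z *\<^sub>R (1 - cos (\<eta> \<bullet> z))"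
  have int: "set_integrable lborel (cball (0::'a) 1) (\<lambda>z. cos (\<eta> \<bullet> z))"
       "set_integrable lborel (cball (0::'a) 1) (\<lambda>z. 1::real)"
    by (rule set_integrable_cball[where B = 1]; simp)+
  have "(\<integral>z. ?f z \<partial>lborel) = 0"
    using set_integral_diff(2)[OF int(2,1)] eq
    by (simp add: unit_ball_ft_def set_lebesgue_integral_def)
  moreover have "integrable lborel ?f"
    using set_integral_diff(1)[OF int(2,1)] by (simp add: set_integrable_def)
  ultimately have ae: "AE z in lborel. ?f z = 0"
    by (subst (asm) integral_nonneg_eq_0_iff_AE) auto
  define S where "S = ball (0::'a) 1 \<inter> {z. cos (\<eta> \<bullet> z) \<noteq> 1}"
  have "open {z. cos (\<eta> \<bullet> z) \<noteq> 1}"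
    by (intro open_Collect_neq continuous_intros)
  then have "open S" unfolding S_def by (intro open_Int) auto
  moreover have "negligible S"
  proof -
    have "AE z in lborel. z \<notin> S"
      using ae by eventually_elim (auto simp: S_def)
    then have "S \<in> null_sets lborel"
      using \<open>open S\<close> by (subst AE_iff_null_sets) auto
    then show ?thesis by (simp add: negligible_iff_null_sets null_sets_completionI)
  qed
  moreover have "S \<noteq> {}"
  proof -
    \<comment> \<open>Small enough for \<open>t \<eta>\<close> to lie in the unit ball and for \<open>\<eta> \<bullet> t \<eta>\<close> to lie in \<open>(0, 1]\<close>, where the cosine is below \<open>1\<close>.\<close>
    define t where "t = min (1 / (2 * norm \<eta>)) (1 / (norm \<eta>)\<^sup>2)"
    have "t > 0" "t * norm \<eta> < 1" "t * (norm \<eta>)\<^sup>2 \<le> 1"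
      using assms by (auto simp: t_def min_def field_simps power2_eq_square)
    have "cos (t * (norm \<eta>)\<^sup>2) < cos 0"
      using \<open>t > 0\<close> \<open>t * (norm \<eta>)\<^sup>2 \<le> 1\<close> assms pi_gt3 by (intro cos_monotone_0_pi) auto
    then have "t *\<^sub>R \<eta> \<in> S"
      using \<open>t > 0\<close> \<open>t * norm \<eta> < 1\<close> by (auto simp: S_def power2_norm_eq_inner)
    then show ?thesis by blast
  qed
  ultimately show False using open_not_negligible by blast
qed

lemma lborel_integral_affine:
  fixes f :: "'a::euclidean_space \<Rightarrow> 'b::{banach, second_countable_topology}"
  assumes [measurable]: "f \<in> borel_measurable borel" and "c \<noteq> 0"
  shows "(\<integral>x. f x \<partial>lborel) = (\<bar>c\<bar> ^ DIM('a)) *\<^sub>R (\<integral>x. f (t + c *\<^sub>R x) \<partial>lborel)"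
  by (subst lborel_affine[OF \<open>c \<noteq> 0\<close>, of t]) (simp add: integral_density integral_distr)

text \<open>
  Rescaling to the unit ball gives the factor \<open>r ^ DIM('a)\<close>. The integral is real because reflection at
  the origin preserves Lebesgue measure and conjugates the integrand.
\<close>

lemma cball_exp_integral:
  fixes \<xi> :: "'a::euclidean_space"
  assumes "r > 0"
  shows "(LINT z:cball 0 r|lborel. exp (\<i> * complex_of_real (\<xi> \<bullet> z))) =
    complex_of_real (r ^ DIM('a) * unit_ball_ft (r *\<^sub>R \<xi>))"
proof -
  define g where "g z = indicator (cball (0::'a) 1) z *\<^sub>R exp (\<i> * complex_of_real (r *\<^sub>R \<xi> \<bullet> z))" for z
  have [measurable]: "g \<in> borel_measurable borel" unfolding g_def
    by (intro borel_measurable_scaleR borel_measurable_indicator borel_measurable_continuous_onI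
        continuous_intros) auto
  have int: "set_integrable lborel (cball (0::'a) 1) (\<lambda>z. exp (\<i> * complex_of_real (r *\<^sub>R \<xi> \<bullet> z)))"
    by (rule set_integrable_cball[where B = 1]) (auto simp: norm_exp_i_times intro!: borel_measurable_continuous_onI continuous_intros)
  then have g: "integrable lborel g"
    by (simp add: set_integrable_def g_def[abs_def])
  have "(LINT z:cball 0 r|lborel. exp (\<i> * complex_of_real (\<xi> \<bullet> z))) = (r ^ DIM('a)) *\<^sub>R (\<integral>z. g z \<partial>lborel)"
    unfolding set_lebesgue_integral_def
    by (subst lborel_integral_affine[of _ r 0])
       (use assms in \<open>auto simp: g_def indicator_def inner_commute intro!: Bochner_Integration.integral_cong\<close>)
  moreover have "(\<integral>z. g z \<partial>lborel) = complex_of_real (unit_ball_ft (r *\<^sub>R \<xi>))"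
  proof -
    have "(\<integral>z. g z \<partial>lborel) = (\<integral>z. g (- z) \<partial>lborel)"
      by (subst lborel_integral_affine[of g "-1" 0]) simp_all
    also have "\<dots> = (\<integral>z. cnj (g z) \<partial>lborel)"
      by (intro Bochner_Integration.integral_cong) (simp_all add: g_def indicator_def exp_cnj)
    also have "\<dots> = cnj (\<integral>z. g z \<partial>lborel)"
      by (rule Bochner_Integration.integral_cnj)
    finally have "Im (\<integral>z. g z \<partial>lborel) = 0"
      by (metis Im_complex_of_real Reals_cnj_iff complex_is_Real_iff)
    moreover have "Re (g z) = indicator (cball 0 1) z *\<^sub>R cos (r *\<^sub>R \<xi> \<bullet> z)" for z
      by (simp add: g_def Re_exp)
    then have "Re (\<integral>z. g z \<partial>lborel) = unit_ball_ft (r *\<^sub>R \<xi>)"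
      by (simp only: integral_Re[OF g, symmetric] unit_ball_ft_def set_lebesgue_integral_def)
    ultimately show ?thesis by (simp add: complex_eq_iff)
  qed
  ultimately show ?thesis by (simp add: scaleR_conv_of_real)
qed

section \<open>The Fourier multiplier of the dyadic differences\<close>

text \<open>
  The Fourier transform, at frequency \<open>\<xi>\<close>, of \<open>Delta k\<close> applied in the radius to the indicator of
  the centred ball: \<open>\<rho> ^ DIM('a) * unit_ball_ft (\<rho> \<xi>)\<close> is the transform of the ball of radius \<open>\<rho>\<close>.
\<close>

definition shell_multiplier :: "nat \<Rightarrow> real \<Rightarrow> 'a::euclidean_space \<Rightarrow> real" where
  "shell_multiplier k r \<xi> = Delta k (\<lambda>\<rho>. \<rho> ^ DIM('a) * unit_ball_ft (\<rho> *\<^sub>R \<xi>)) r"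

text \<open>
  Homogeneity: a frequency of size \<open>L\<close> seen at radius \<open>u / L\<close> looks like a unit frequency at radius
  \<open>u\<close>. It reduces all frequencies to the unit sphere.
\<close>

lemma shell_multiplier_scale:
  fixes \<xi> :: "'a::euclidean_space"
  shows "shell_multiplier k (c * r) \<xi> = c ^ DIM('a) * shell_multiplier k r (c *\<^sub>R \<xi>)"
proof -
  obtain a where a: "\<And>F r. Delta k F r = (\<Sum>i\<le>Suc k. a i * F (r / 2 ^ i))"
    using Delta_eq_sum by blast
  show ?thesis
    unfolding shell_multiplier_def a sum_distrib_left
    by (intro sum.cong) (simp_all add: power_mult_distrib power_divide mult_ac)
qed

lemma continuous_on_shell_multiplier:
  "continuous_on A (\<lambda>(\<xi>::'a::euclidean_space, r). shell_multiplier k r \<xi>)"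
proof -
  obtain a where a: "\<And>F r. Delta k F r = (\<Sum>i\<le>Suc k. a i * F (r / 2 ^ i))"
    using Delta_eq_sum by blast
  show ?thesis
    unfolding shell_multiplier_def a split_beta
    by (intro continuous_intros continuous_on_compose2[OF continuous_on_unit_ball_ft[of UNIV]]) auto
qed

lemma continuous_on_shell_multiplier_radius:
  fixes \<xi> :: "'a::euclidean_space"
  shows "continuous_on S (\<lambda>r. shell_multiplier k r \<xi>)"
proof -
  have "continuous_on S (Pair \<xi>)" by (intro continuous_intros)
  from continuous_on_compose2[OF continuous_on_shell_multiplier[of UNIV k] this] show ?thesis
    by simp
qed

lemma shell_multiplier_ne_0:
  fixes e :: "'a::euclidean_space"
  assumes "e \<noteq> 0"
  shows "\<exists>r>0. shell_multiplier k r e \<noteq> 0"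
  unfolding shell_multiplier_def
proof (rule Delta_homogeneous_ne_0[where u = 1])
  have "continuous_on UNIV (\<lambda>r::real. unit_ball_ft (r *\<^sub>R e))"
    by (intro continuous_on_compose2[OF continuous_on_unit_ball_ft[of UNIV]] continuous_intros) auto
  then have "isCont (\<lambda>r::real. unit_ball_ft (r *\<^sub>R e)) 0"
    by (simp add: continuous_on_eq_continuous_at)
  then show "((\<lambda>r::real. unit_ball_ft (r *\<^sub>R e)) \<longlongrightarrow> unit_ball_ft (0::'a)) (at_right 0)"
    unfolding isCont_def by (simp add: filterlim_at_split)
  show "unit_ball_ft (1 *\<^sub>R e) \<noteq> unit_ball_ft (0::'a)"
    using unit_ball_ft_ne_volume[OF assms] by (simp add: unit_ball_ft_0)
qed (auto intro: abs_unit_ball_ft_le)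

text \<open>
  Along the increasing windows \<open>[1/(n+2), n+2]\<close> the integrals increase, depend continuously on the
  direction, and become positive for each direction. By compactness of the sphere one window serves
  all directions, and the minimum over the sphere is then positive.
\<close>

lemma shell_multiplier_integral_bounded_below:
  fixes \<beta> :: real
  obtains c C m where "0 < c" "c < C" "0 < m"
    "\<And>e::'a::euclidean_space. norm e = 1 \<Longrightarrow>
       m \<le> integral {c..C} (\<lambda>u. u powr \<beta> * \<bar>shell_multiplier k u e\<bar>)"
proof -
  let ?w = "\<lambda>(e::'a) u. u powr \<beta> * \<bar>shell_multiplier k u e\<bar>"
  define lo hi :: "nat \<Rightarrow> real" where "lo n = 1 / (real n + 2)" and "hi n = real n + 2" for n
  define f where "f n e = integral {lo n..hi n} (?w e)" for n e
  have lo_pos: "lo n > 0" and lo_hi: "lo n < hi n" for n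
    by (auto simp: lo_def hi_def field_simps intro: add_pos_nonneg)
  have cont_w: "continuous_on (UNIV \<times> cbox (lo n) (hi n)) (\<lambda>(e, u). ?w e u)" for n
    using continuous_on_shell_multiplier[of "(UNIV :: 'a set) \<times> cbox (lo n) (hi n)" k] lo_pos[of n]
    unfolding split_beta by (intro continuous_intros) auto
  have cont_we: "continuous_on {lo n..hi n} (?w e)" for n e
    using lo_pos[of n] by (intro continuous_intros continuous_on_shell_multiplier_radius) auto
  have cont_f: "continuous_on UNIV (f n)" for n
    using integral_continuous_on_param[OF cont_w[of n]] by (simp add: f_def[abs_def])
  have mono_f: "f i e \<le> f n e" if "i \<le> n" for i n e
  proof -
    have "lo n \<le> lo i" "hi i \<le> hi n"
      using that by (auto simp: lo_def hi_def intro!: divide_left_mono)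
    then show ?thesis
      unfolding f_def
      by (intro integral_subset_le integrable_continuous_real cont_we) auto
  qed
  have pos_f: "\<exists>n. f n e > 0" if "norm e = 1" for e
  proof -
    have "e \<noteq> 0" using that by auto
    then obtain u where u: "u > 0" "shell_multiplier k u e \<noteq> 0"
      using shell_multiplier_ne_0 by blast
    define n where "n = nat \<lceil>max u (1 / u)\<rceil>"
    have "max u (1 / u) \<le> real n"
      unfolding n_def by (rule real_nat_ceiling_ge)
    then have "u \<le> hi n" "1 / u \<le> hi n" by (auto simp: hi_def)
    then have "u \<in> {lo n..hi n}"
      using u(1) by (auto simp: hi_def lo_def field_simps)
    moreover have "?w e u \<noteq> 0" using u by simp
    ultimately have "f n e \<noteq> 0"
      unfolding f_def using integral_eq_0_iff[OF cont_we lo_hi, of n e] by auto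
    moreover have "f n e \<ge> 0"
      unfolding f_def by (intro integral_nonneg integrable_continuous_real cont_we) auto
    ultimately show ?thesis by (intro exI[of _ n]) simp
  qed
  obtain I where I: "finite I" "sphere (0::'a) 1 \<subseteq> (\<Union>n\<in>I. {e. 0 < f n e})"
    by (rule compactE_image[of "sphere (0::'a) 1" UNIV "\<lambda>n. {e. 0 < f n e}"])
       (use pos_f in \<open>auto intro!: open_Collect_less cont_f continuous_intros\<close>)
  define N where "N = Max (insert 0 I)"
  have pos_N: "f N e > 0" if "norm e = 1" for e
  proof -
    have "e \<in> (\<Union>n\<in>I. {e. 0 < f n e})" using I(2) that by auto
    then obtain n where n: "n \<in> I" "0 < f n e" by auto
    then have "n \<le> N" using I(1) by (auto simp: N_def)
    with mono_f[OF this, of e] n show ?thesis by simp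
  qed
  have "sphere (0::'a) 1 \<noteq> {}"
    using vector_choose_size[of 1, where 'a = 'a] by auto
  then obtain e0 where e0: "norm e0 = 1" "\<And>e. norm e = 1 \<Longrightarrow> f N e0 \<le> f N e"
    using continuous_attains_inf[OF compact_sphere _ continuous_on_subset[OF cont_f[of N]], of 0 1]
    by auto
  show ?thesis
    by (rule that[of "lo N" "hi N" "f N e0"])
       (use lo_pos lo_hi pos_N e0 in \<open>auto simp: f_def\<close>)
qed

section \<open>Weighted norms\<close>

lemma ennreal_powr_mono: "x \<le> y \<Longrightarrow> 0 \<le> a \<Longrightarrow> ennreal_powr x a \<le> ennreal_powr y a"
  by (cases x; cases y) (auto simp: ennreal_powr_def top_unique intro!: powr_mono2)

lemma borel_measurable_ennreal_powr [measurable]: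
  assumes [measurable]: "f \<in> borel_measurable M"
  shows "(\<lambda>x. ennreal_powr (f x) a) \<in> borel_measurable M"
  unfolding ennreal_powr_def by measurable

lemma Lp_norm_mono:
  assumes "f \<in> borel_measurable M" and "\<And>x. f x \<le> g x"
  shows "Lp_norm p M f \<le> Lp_norm p M g"
  using assms unfolding Lp_norm_def
  by (auto intro!: esssup_mono ennreal_powr_mono nn_integral_mono)

text \<open>
  For finite \<open>p\<close>, normalise \<open>f\<close> by its norm and integrate
  \<open>x \<le> 1 + x powr p\<close> over \<open>A\<close>. This gives the factor \<open>emeasure M A + 1\<close> in place of the optimal
  power of \<open>emeasure M A\<close>; the advantage is a constant independent of \<open>p\<close>.
\<close>

lemma nn_integral_le_Lp_norm:
  assumes f [measurable]: "f \<in> borel_measurable M" and A [measurable]: "A \<in> sets M" and "1 \<le> p"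
  shows "(\<integral>\<^sup>+ x. f x * indicator A x \<partial>M) \<le> (emeasure M A + 1) * Lp_norm p M f"
proof (cases "p = top")
  case True
  have "(\<integral>\<^sup>+ x. f x * indicator A x \<partial>M) \<le> (\<integral>\<^sup>+ x. esssup M f * indicator A x \<partial>M)"
    using esssup_AE[of f M] by (intro nn_integral_mono_AE) (auto elim!: eventually_mono intro!: mult_right_mono)
  also have "\<dots> = emeasure M A * esssup M f"
    by (simp add: nn_integral_cmult_indicator mult.commute)
  also have "\<dots> \<le> (emeasure M A + 1) * esssup M f"
    by (intro mult_right_mono) auto
  finally show ?thesis using True by (simp add: Lp_norm_def)
next
  case False
  define P where "P = enn2real p"
  have P: "P \<ge> 1"
    using \<open>1 \<le> p\<close> False unfolding P_def by (cases p) auto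
  define J where "J = (\<integral>\<^sup>+ x. ennreal_powr (f x) P \<partial>M)"
  have N: "Lp_norm p M f = ennreal_powr J (1 / P)"
    using False by (simp add: Lp_norm_def J_def P_def)
  consider "J = top" | "J = 0" | j where "J = ennreal j" "j > 0"
    by (cases J) (auto simp: less_eq_real_def)
  then show ?thesis
  proof cases
    case 1
    then show ?thesis by (simp add: N ennreal_powr_def ennreal_mult_top add_nonneg_eq_0_iff)
  next
    case 2
    then have "AE x in M. ennreal_powr (f x) P = 0"
      unfolding J_def by (subst (asm) nn_integral_0_iff_AE) auto
    then have "AE x in M. f x * indicator A x = 0"
    proof eventually_elim
      case (elim x)
      then show ?case by (cases "f x") (auto simp: ennreal_powr_def split: if_splits)
    qed
    then have "(\<integral>\<^sup>+ x. f x * indicator A x \<partial>M) = 0"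
      by (subst nn_integral_0_iff_AE) auto
    then show ?thesis by simp
  next
    case 3
    define n where "n = j powr (1 / P)"
    have "n > 0" using 3 by (simp add: n_def)
    have nP: "n powr P = j" using 3 P by (simp add: n_def powr_powr)
    have pointwise: "f x * indicator A x \<le> ennreal n * indicator A x + ennreal (n / j) * ennreal_powr (f x) P" for x
    proof (cases "f x")
      case top
      then show ?thesis
        using \<open>n > 0\<close> 3 by (simp add: ennreal_powr_def ennreal_mult_top)
    next
      case (real t)
      have "t \<le> n + n / j * t powr P"
      proof (cases "t \<le> n")
        case True
        then show ?thesis using \<open>n > 0\<close> 3 by (simp add: add_increasing2)
      next
        case False
        then have "t / n = (t / n) powr 1" using \<open>n > 0\<close> by simp
        also have "\<dots> \<le> (t / n) powr P"
          using False \<open>n > 0\<close> P by (intro powr_mono) auto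
        also have "\<dots> = t powr P / j"
          using False \<open>n > 0\<close> by (simp add: powr_divide nP)
        finally have "t \<le> n / j * t powr P" using \<open>n > 0\<close> 3 by (simp add: field_simps)
        then show ?thesis using \<open>n > 0\<close> by simp
      qed
      then have "ennreal t \<le> ennreal n + ennreal (n / j) * ennreal (t powr P)"
        using \<open>n > 0\<close> 3 by (simp flip: ennreal_mult'' ennreal_plus)
      then show ?thesis
        using real by (auto simp: ennreal_powr_def indicator_def)
    qed
    have "(\<integral>\<^sup>+ x. f x * indicator A x \<partial>M) \<le>
        (\<integral>\<^sup>+ x. ennreal n * indicator A x + ennreal (n / j) * ennreal_powr (f x) P \<partial>M)"
      by (intro nn_integral_mono pointwise)
    also have "\<dots> = ennreal n * emeasure M A + ennreal (n / j) * J"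
      by (simp add: nn_integral_add nn_integral_cmult nn_integral_cmult_indicator J_def)
    also have "ennreal (n / j) * J = ennreal n"
      using 3 \<open>n > 0\<close> by (simp flip: ennreal_mult'')
    also have "ennreal n * emeasure M A + ennreal n = (emeasure M A + 1) * ennreal n"
      by (simp add: distrib_left distrib_right mult.commute)
    also have "ennreal n = Lp_norm p M f"
      using 3 by (simp add: N ennreal_powr_def n_def)
    finally show ?thesis .
  qed
qed

lemma borel_measurable_dr_over_r:
  "f \<in> borel_measurable borel \<Longrightarrow> f \<in> borel_measurable dr_over_r"
  unfolding dr_over_r_def measurable_density_eq1 by (intro measurable_restrict_space1) simp

lemma sets_dr_over_r: "S \<in> sets borel \<Longrightarrow> S \<subseteq> {0<..} \<Longrightarrow> S \<in> sets dr_over_r"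
  by (simp add: dr_over_r_def sets_restrict_space_iff)

lemma nn_integral_dr_over_r:
  assumes [measurable]: "f \<in> borel_measurable borel" "S \<in> sets borel" and "S \<subseteq> {0<..}"
  shows "(\<integral>\<^sup>+ r. f r * indicator S r \<partial>dr_over_r) =
    (\<integral>\<^sup>+ r. ennreal (1 / r) * (f r * indicator S r) \<partial>lborel)"
proof -
  have "(\<integral>\<^sup>+ r. f r * indicator S r \<partial>dr_over_r) =
      (\<integral>\<^sup>+ r. ennreal (1 / r) * (f r * indicator S r) \<partial>restrict_space lborel {0<..})"
    unfolding dr_over_r_def
    by (intro nn_integral_density measurable_restrict_space1) measurable
  also have "\<dots> = (\<integral>\<^sup>+ r. ennreal (1 / r) * (f r * indicator S r) * indicator {0<..} r \<partial>lborel)"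
    by (subst nn_integral_restrict_space) simp_all
  also have "\<dots> = (\<integral>\<^sup>+ r. ennreal (1 / r) * (f r * indicator S r) \<partial>lborel)"
    using \<open>S \<subseteq> {0<..}\<close> by (intro nn_integral_cong) (auto simp: indicator_def)
  finally show ?thesis .
qed

text \<open>
  The \<open>dr / r\<close>-mass of a window is scale invariant, so a single constant serves all frequencies \<open>L\<close>.
  The extra \<open>1\<close> is the one produced by \<open>nn_integral_le_Lp_norm\<close>.
\<close>

lemma emeasure_dr_over_r_interval_le:
  assumes "0 < c" "c < C" "0 < L"
  shows "emeasure dr_over_r {c / L..C / L} + 1 \<le> ennreal (C / c)"
proof -
  let ?I = "{c / L..C / L}"
  have I: "?I \<subseteq> {0<..}"
  proof
    fix r assume "r \<in> ?I"
    moreover have "c / L > 0" using assms by simp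
    ultimately show "r \<in> {0<..}" by auto
  qed
  have "emeasure dr_over_r ?I = (\<integral>\<^sup>+ r. 1 * indicator ?I r \<partial>dr_over_r)"
    using sets_dr_over_r[OF _ I] by simp
  also have "\<dots> = (\<integral>\<^sup>+ r. ennreal (1 / r) * (1 * indicator ?I r) \<partial>lborel)"
    using I by (intro nn_integral_dr_over_r) auto
  also have "\<dots> \<le> (\<integral>\<^sup>+ r. ennreal (L / c) * indicator ?I r \<partial>lborel)"
  proof (intro nn_integral_mono)
    fix r :: real
    show "ennreal (1 / r) * (1 * indicator ?I r) \<le> ennreal (L / c) * indicator ?I r"
    proof (cases "r \<in> ?I")
      case True
      then have "c / L \<le> r" "r > 0" using I by auto
      then have "1 / r \<le> L / c" using assms by (simp add: field_simps)
      then show ?thesis using True by (simp add: ennreal_leI)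
    qed simp
  qed
  also have "\<dots> = ennreal (L / c) * ennreal (C / L - c / L)"
    using assms by (simp add: nn_integral_cmult_indicator divide_right_mono)
  also have "\<dots> = ennreal (C / c - 1)"
    using assms by (simp add: field_simps flip: ennreal_mult'')
  finally have "emeasure dr_over_r ?I + 1 \<le> ennreal (C / c - 1) + ennreal 1"
    by (simp add: add_right_mono)
  also have "\<dots> = ennreal (C / c)"
    using assms by (subst ennreal_plus[symmetric]) auto
  finally show ?thesis .
qed

text \<open>
  The comparison of an integral with an \<open>L\<^sup>p\<close> norm, used first in \<open>r\<close> and then in \<open>y\<close>. The inner norm
  is not known to be measurable in \<open>y\<close> when \<open>p\<close> is infinite; therefore the outer comparison is made
  for the measurable function \<open>M\<close>, scaled by \<open>1 / K\<close> so that it lies below the inner norm, and only then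
  is the monotonicity of the outer norm used.
\<close>

lemma iterated_integral_le_mixed_Lp_norm:
  fixes G :: "'a::euclidean_space \<Rightarrow> real \<Rightarrow> ennreal"
  assumes G: "(\<lambda>(y, r). G y r) \<in> borel_measurable (borel \<Otimes>\<^sub>M borel)"
    and "1 \<le> p" "1 \<le> q" and "B \<in> sets borel" and "0 < c" "c < C" "0 < L"
  defines "I \<equiv> {c / L..C / L}"
  shows "(\<integral>\<^sup>+ r. \<integral>\<^sup>+ y. ennreal (1 / r) * (G y r * indicator I r) * indicator B y \<partial>lborel \<partial>lborel)
    \<le> ennreal (C / c) * ((emeasure lborel B + 1) * Lp_norm q lborel (\<lambda>y. Lp_norm p dr_over_r (G y)))"
proof -
  note G' [measurable] = G[unfolded split_beta']
  note [measurable] = \<open>B \<in> sets borel\<close>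
  have Gy [measurable]: "G y \<in> borel_measurable borel" for y
    using measurable_compose[of "Pair y" borel, OF _ G] by simp
  have I [measurable]: "I \<in> sets borel" "I \<subseteq> {0<..}"
  proof -
    have "c / L > 0" using assms by simp
    then show "I \<subseteq> {0<..}" unfolding I_def by (metis atLeastAtMost_iff greaterThan_iff less_le_trans subsetI)
  qed (simp add: I_def)
  define K where "K = C / c"
  have "K > 0" using assms by (simp add: K_def)
  define M where "M y = (\<integral>\<^sup>+ r. ennreal (1 / r) * (G y r * indicator I r) \<partial>lborel)" for y
  have M_meas [measurable]: "M \<in> borel_measurable borel"
    unfolding M_def by measurable
  have M_le: "ennreal (1 / K) * M y \<le> Lp_norm p dr_over_r (G y)" for y
  proof -
    have "M y = (\<integral>\<^sup>+ r. G y r * indicator I r \<partial>dr_over_r)"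
      unfolding M_def using I by (intro nn_integral_dr_over_r[symmetric] Gy)
    also have "\<dots> \<le> (emeasure dr_over_r I + 1) * Lp_norm p dr_over_r (G y)"
      using I by (intro nn_integral_le_Lp_norm borel_measurable_dr_over_r sets_dr_over_r Gy assms)
    also have "\<dots> \<le> ennreal K * Lp_norm p dr_over_r (G y)"
      unfolding I_def K_def using assms by (intro mult_right_mono emeasure_dr_over_r_interval_le) auto
    finally have "ennreal (1 / K) * M y \<le> ennreal (1 / K) * (ennreal K * Lp_norm p dr_over_r (G y))"
      by (intro mult_left_mono) auto
    also have "\<dots> = Lp_norm p dr_over_r (G y)"
      using \<open>K > 0\<close> by (simp flip: mult.assoc ennreal_mult'')
    finally show ?thesis .
  qed
  have "(\<integral>\<^sup>+ r. \<integral>\<^sup>+ y. ennreal (1 / r) * (G y r * indicator I r) * indicator B y \<partial>lborel \<partial>lborel) =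
      (\<integral>\<^sup>+ y. \<integral>\<^sup>+ r. ennreal (1 / r) * (G y r * indicator I r) * indicator B y \<partial>lborel \<partial>lborel)"
    by (rule lborel_pair.Fubini') measurable
  also have "\<dots> = (\<integral>\<^sup>+ y. M y * indicator B y \<partial>lborel)"
    unfolding M_def by (intro nn_integral_cong nn_integral_multc) measurable
  also have "\<dots> = (\<integral>\<^sup>+ y. ennreal K * ((ennreal (1 / K) * M y) * indicator B y) \<partial>lborel)"
    using \<open>K > 0\<close> by (simp flip: mult.assoc ennreal_mult'')
  also have "\<dots> = ennreal K * (\<integral>\<^sup>+ y. (ennreal (1 / K) * M y) * indicator B y \<partial>lborel)"
    by (rule nn_integral_cmult) measurable
  also have "\<dots> \<le> ennreal K * ((emeasure lborel B + 1) * Lp_norm q lborel (\<lambda>y. ennreal (1 / K) * M y))"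
    using assms by (intro mult_left_mono nn_integral_le_Lp_norm) auto
  also have "\<dots> \<le> ennreal K * ((emeasure lborel B + 1) * Lp_norm q lborel (\<lambda>y. Lp_norm p dr_over_r (G y)))"
    by (intro mult_left_mono Lp_norm_mono M_le) auto
  finally show ?thesis by (simp add: K_def)
qed

section \<open>Fourier transforms of ball masses\<close>

text \<open>
  The masses are those of the sections of the closed set \<open>dist y x \<le> r\<close> in the triple product.
\<close>

lemma measurable_cball_mass:
  fixes \<nu> :: "'a::euclidean_space measure"
  assumes "finite_measure \<nu>" and [measurable_cong]: "sets \<nu> = sets borel"
  shows "(\<lambda>(y, r). measure \<nu> (cball y r)) \<in> borel_measurable (borel \<Otimes>\<^sub>M borel)"
proof -
  interpret finite_measure \<nu> by fact
  let ?Q = "{q :: ('a \<times> real) \<times> 'a. dist (fst (fst q)) (snd q) \<le> snd (fst q)}"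
  have "closed ?Q" by (intro closed_Collect_le continuous_intros)
  moreover have "sets (borel \<Otimes>\<^sub>M \<nu>) = sets (borel :: (('a \<times> real) \<times> 'a) measure)"
    using sets_pair_measure_cong[OF refl assms(2), of "borel :: ('a \<times> real) measure"]
    by (simp only: borel_prod)
  ultimately have "?Q \<in> sets (borel \<Otimes>\<^sub>M \<nu>)" by simp
  from measurable_emeasure_Pair[OF this]
  have "(\<lambda>p. emeasure \<nu> (cball (fst p) (snd p))) \<in> borel_measurable (borel :: ('a \<times> real) measure)"
    by (simp add: vimage_def cball_def)
  then show ?thesis
    by (simp add: measure_def borel_prod split_beta)
qed

lemma measurable_Delta_cball_mass:
  fixes \<nu> :: "'a::euclidean_space measure"
  assumes "finite_measure \<nu>" and "sets \<nu> = sets borel"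
  shows "(\<lambda>(y, r). Delta k (\<lambda>\<rho>. measure \<nu> (cball y \<rho>)) r) \<in> borel_measurable (borel \<Otimes>\<^sub>M borel)"
proof -
  obtain a where a: "\<And>F r. Delta k F r = (\<Sum>i\<le>Suc k. a i * F (r / 2 ^ i))"
    using Delta_eq_sum by blast
  have [measurable]: "(\<lambda>p::'a \<times> real. measure \<nu> (cball (fst p) (snd p / 2 ^ i))) \<in>
      borel_measurable (borel \<Otimes>\<^sub>M borel)" for i
    using measurable_compose[of "\<lambda>p::'a \<times> real. (fst p, snd p / 2 ^ i)", OF _ measurable_cball_mass[OF assms]]
    by simp
  show ?thesis unfolding a split_beta by measurable
qed

text \<open>
  The convolution theorem for \<open>\<nu>\<close> and the indicator of a ball: integrate
  \<open>exp (\<i> * (\<xi> \<bullet> y))\<close> over the pairs at distance at most \<open>r\<close> in both orders.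
\<close>

lemma cball_mass_Fourier:
  fixes \<nu> :: "'a::euclidean_space measure" and \<xi> :: 'a
  defines "e \<equiv> (\<lambda>y. exp (\<i> * complex_of_real (\<xi> \<bullet> y)))"
  assumes "finite_measure \<nu>" and [measurable_cong]: "sets \<nu> = sets borel" and "r > 0"
  shows "integrable lborel (\<lambda>y. e y * complex_of_real (measure \<nu> (cball y r)))"
    and "(\<integral>y. e y * complex_of_real (measure \<nu> (cball y r)) \<partial>lborel) =
      (\<integral>x. e x \<partial>\<nu>) * complex_of_real (r ^ DIM('a) * unit_ball_ft (r *\<^sub>R \<xi>))"
proof -
  interpret finite_measure \<nu> by fact
  interpret pair_sigma_finite \<nu> lborel ..
  have e_meas [measurable]: "e \<in> borel_measurable borel"
    unfolding e_def by (intro borel_measurable_continuous_onI continuous_intros)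
  have norm_e: "norm (e y) = 1" for y by (simp add: e_def)
  define f where "f x y = indicator (cball x r) y *\<^sub>R e y" for x y
  have f_sym: "f x y = indicator (cball y r) x *\<^sub>R e y" for x y
    by (simp add: f_def indicator_def dist_commute)
  have f_meas: "(\<lambda>(x, y). f x y) \<in> borel_measurable (\<nu> \<Otimes>\<^sub>M lborel)"
  proof -
    have "closed {p::'a \<times> 'a. dist (fst p) (snd p) \<le> r}"
      by (intro closed_Collect_le continuous_intros)
    moreover have "sets (\<nu> \<Otimes>\<^sub>M lborel) = sets (borel :: ('a \<times> 'a) measure)"
      using sets_pair_measure_cong[OF assms(3) sets_lborel] by (simp only: borel_prod)
    ultimately have [measurable]: "{p::'a \<times> 'a. dist (fst p) (snd p) \<le> r} \<in> sets (\<nu> \<Otimes>\<^sub>M lborel)"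
      by simp
    have "(\<lambda>(x, y). f x y) =
        (\<lambda>p. indicator {p. dist (fst p) (snd p) \<le> r} p *\<^sub>R e (snd p))"
      by (auto simp: f_def indicator_def)
    then show ?thesis by simp
  qed
  have int_x: "integrable lborel (f x)" for x
    using set_integrable_cball[OF e_meas, of 1 x r] norm_e by (simp add: set_integrable_def f_def[abs_def])
  have "integrable \<nu> (\<lambda>x. \<integral>y. norm (f x y) \<partial>lborel)"
    using \<open>r > 0\<close> by (simp add: f_def norm_e content_cball)
  then have int: "integrable (\<nu> \<Otimes>\<^sub>M lborel) (\<lambda>(x, y). f x y)"
    using int_x f_meas by (intro Fubini_integrable) auto
  have inner_y: "(\<integral>x. f x y \<partial>\<nu>) = e y * complex_of_real (measure \<nu> (cball y r))" for y
    by (simp add: f_sym scaleR_conv_of_real mult.commute)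
  have inner_x: "(\<integral>y. f x y \<partial>lborel) = e x * complex_of_real (r ^ DIM('a) * unit_ball_ft (r *\<^sub>R \<xi>))" for x
  proof -
    have "(\<integral>y. f x y \<partial>lborel) = (\<integral>z. f x (x + z) \<partial>lborel)"
      using borel_measurable_integrable[OF int_x[of x]]
      by (subst lborel_integral_affine[of _ 1 x]) simp_all
    also have "\<dots> = (\<integral>z. e x * (indicator (cball 0 r) z *\<^sub>R e z) \<partial>lborel)"
      by (intro Bochner_Integration.integral_cong)
         (simp_all add: f_def e_def indicator_def inner_add_right distrib_left exp_add dist_norm)
    also have "\<dots> = e x * (LINT z:cball 0 r|lborel. e z)"
      unfolding set_lebesgue_integral_def
      by (rule Bochner_Integration.integral_mult_right_zero)
    finally show ?thesis
      using cball_exp_integral[OF \<open>r > 0\<close>, of \<xi>] by (simp add: e_def)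
  qed
  show "integrable lborel (\<lambda>y. e y * complex_of_real (measure \<nu> (cball y r)))"
    using integrable_snd[OF int] by (simp add: inner_y)
  have "(\<integral>y. \<integral>x. f x y \<partial>\<nu> \<partial>lborel) = (\<integral>x. \<integral>y. f x y \<partial>lborel \<partial>\<nu>)"
    by (rule Fubini_integral[OF int])
  then show "(\<integral>y. e y * complex_of_real (measure \<nu> (cball y r)) \<partial>lborel) =
      (\<integral>x. e x \<partial>\<nu>) * complex_of_real (r ^ DIM('a) * unit_ball_ft (r *\<^sub>R \<xi>))"
    unfolding inner_x inner_y by simp
qed

text \<open>
  The sup bound of a Fourier transform by the \<open>L\<^sup>1\<close> norm, applied to the dyadic difference of the
  convolution of \<open>\<nu>\<close> with balls, whose transform factors.
\<close>

lemma Fourier_times_shell_multiplier_le: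
  fixes \<nu> :: "'a::euclidean_space measure" and \<xi> :: 'a
  assumes "finite_measure \<nu>" and "sets \<nu> = sets borel" and "r > 0"
  shows "ennreal (norm (\<integral>x. exp (\<i> * complex_of_real (\<xi> \<bullet> x)) \<partial>\<nu>) * \<bar>shell_multiplier k r \<xi>\<bar>)
    \<le> (\<integral>\<^sup>+y. ennreal \<bar>Delta k (\<lambda>\<rho>. measure \<nu> (cball y \<rho>)) r\<bar> \<partial>lborel)"
proof -
  define e where "e y = exp (\<i> * complex_of_real (\<xi> \<bullet> y))" for y
  obtain a where a: "\<And>F r. Delta k F r = (\<Sum>i\<le>Suc k. a i * F (r / 2 ^ i))"
    using Delta_eq_sum by blast
  let ?D = "\<lambda>y. Delta k (\<lambda>\<rho>. measure \<nu> (cball y \<rho>)) r"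
  have "r / 2 ^ i > 0" for i using \<open>r > 0\<close> by simp
  note F = cball_mass_Fourier[OF assms(1,2) this, of \<xi>, folded e_def]
  have D: "e y * complex_of_real (?D y) =
      (\<Sum>i\<le>Suc k. of_real (a i) * (e y * complex_of_real (measure \<nu> (cball y (r / 2 ^ i)))))" for y
    unfolding a by (simp add: sum_distrib_left mult_ac del: sum.atMost_Suc)
  have int: "integrable lborel (\<lambda>y. e y * complex_of_real (?D y))"
    unfolding D by (intro Bochner_Integration.integrable_sum integrable_mult_right F(1))
  have "(\<integral>y. e y * complex_of_real (?D y) \<partial>lborel) =
      (\<Sum>i\<le>Suc k. \<integral>y. of_real (a i) * (e y * complex_of_real (measure \<nu> (cball y (r / 2 ^ i)))) \<partial>lborel)"
    unfolding D by (intro Bochner_Integration.integral_sum integrable_mult_right F(1))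
  also have "\<dots> = (\<Sum>i\<le>Suc k. of_real (a i) *
      ((\<integral>x. e x \<partial>\<nu>) * complex_of_real ((r / 2 ^ i) ^ DIM('a) * unit_ball_ft ((r / 2 ^ i) *\<^sub>R \<xi>))))"
    by (simp only: Bochner_Integration.integral_mult_right_zero F(2))
  also have "\<dots> = (\<integral>x. e x \<partial>\<nu>) * complex_of_real (shell_multiplier k r \<xi>)"
    by (simp add: shell_multiplier_def a sum_distrib_left mult_ac del: sum.atMost_Suc)
  finally have "(\<integral>y. e y * complex_of_real (?D y) \<partial>lborel) =
      (\<integral>x. e x \<partial>\<nu>) * complex_of_real (shell_multiplier k r \<xi>)" .
  then have "norm (\<integral>x. e x \<partial>\<nu>) * \<bar>shell_multiplier k r \<xi>\<bar> =
      norm (\<integral>y. e y * complex_of_real (?D y) \<partial>lborel)"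
    by (simp add: norm_mult)
  also have "ennreal \<dots> \<le> (\<integral>\<^sup>+y. ennreal (norm (e y * complex_of_real (?D y))) \<partial>lborel)"
    by (rule integral_norm_bound_ennreal[OF int])
  also have "\<dots> = (\<integral>\<^sup>+y. ennreal \<bar>?D y\<bar> \<partial>lborel)"
    by (simp add: norm_mult e_def)
  finally show ?thesis by (simp add: e_def)
qed

text \<open>
  All radii that enter \<open>Delta k\<close> at \<open>r\<close> are at most \<open>r\<close>, so for far away centres no ball meets the
  support. This confines the integration in \<open>y\<close> to a set of finite measure.
\<close>

lemma Delta_cball_mass_eq_0:
  fixes \<nu> :: "'a::euclidean_space measure"
  assumes "sets \<nu> = sets borel" and "emeasure \<nu> (- cball 0 R) = 0"
    and "0 < r" "r \<le> C" and "y \<notin> cball 0 (R + C)"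
  shows "Delta k (\<lambda>\<rho>. measure \<nu> (cball y \<rho>)) r = 0"
proof -
  obtain a where a: "\<And>F r. Delta k F r = (\<Sum>i\<le>Suc k. a i * F (r / 2 ^ i))"
    using Delta_eq_sum by blast
  have "measure \<nu> (cball y (r / 2 ^ i)) = 0" for i
  proof -
    have "r / 2 ^ i \<le> r / 1" using \<open>0 < r\<close> by (intro divide_left_mono) auto
    have "cball y (r / 2 ^ i) \<subseteq> - cball 0 R"
    proof
      fix z assume "z \<in> cball y (r / 2 ^ i)"
      then have "norm (y - z) \<le> C"
        using \<open>r / 2 ^ i \<le> r / 1\<close> \<open>r \<le> C\<close> by (simp add: dist_norm)
      then show "z \<in> - cball 0 R"
        using assms(5) norm_triangle_ineq2[of y z] by simp
    qed
    then have "emeasure \<nu> (cball y (r / 2 ^ i)) \<le> emeasure \<nu> (- cball 0 R)"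
      using assms(1) by (intro emeasure_mono) auto
    then show ?thesis using assms(2) by (simp add: measure_def)
  qed
  then show ?thesis unfolding a by simp
qed

section \<open>Fourier decay from the SBE norm\<close>

text \<open>
  The substitution \<open>r = u / L\<close>. The powers of \<open>L\<close> are \<open>\<alpha> + d + 1\<close> from the weight, \<open>-d\<close> from the
  homogeneity of the multiplier and \<open>-1\<close> from \<open>dr\<close>, and they leave \<open>L powr \<alpha>\<close>: this is the source of
  the decay exponent.
\<close>

lemma nn_integral_shell_multiplier_scale:
  fixes \<xi> :: "'a::euclidean_space"
  assumes "\<xi> \<noteq> 0" "0 < c" "c < C" "0 \<le> A"
  defines "L \<equiv> norm \<xi>" and "d \<equiv> real DIM('a)"
  shows "(\<integral>\<^sup>+ r. ennreal (A * (r powr (- \<alpha> - d - 1) * \<bar>shell_multiplier k r \<xi>\<bar>)) * indicator {c / L..C / L} r \<partial>lborel)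
    = ennreal (A * L powr \<alpha> * integral {c..C} (\<lambda>u. u powr (- \<alpha> - d - 1) * \<bar>shell_multiplier k u (\<xi> /\<^sub>R L)\<bar>))"
proof -
  let ?w = "\<lambda>u. u powr (- \<alpha> - d - 1) * \<bar>shell_multiplier k u (\<xi> /\<^sub>R L)\<bar>"
  have "L > 0" using assms by (simp add: L_def)
  have [measurable]: "(\<lambda>r. shell_multiplier k r \<eta>) \<in> borel_measurable borel" for \<eta> :: 'a
    by (intro borel_measurable_continuous_onI continuous_on_shell_multiplier_radius)
  have "(\<integral>\<^sup>+ r. ennreal (A * (r powr (- \<alpha> - d - 1) * \<bar>shell_multiplier k r \<xi>\<bar>)) * indicator {c / L..C / L} r \<partial>lborel)
     = ennreal \<bar>1 / L\<bar> * (\<integral>\<^sup>+ u. ennreal (A * ((0 + 1 / L * u) powr (- \<alpha> - d - 1) * \<bar>shell_multiplier k (0 + 1 / L * u) \<xi>\<bar>)) * indicator {c / L..C / L} (0 + 1 / L * u) \<partial>lborel)"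
    using \<open>L > 0\<close> by (intro nn_integral_real_affine) auto
  also have "\<dots> = (\<integral>\<^sup>+ u. ennreal \<bar>1 / L\<bar> * (ennreal (A * ((0 + 1 / L * u) powr (- \<alpha> - d - 1) * \<bar>shell_multiplier k (0 + 1 / L * u) \<xi>\<bar>)) * indicator {c / L..C / L} (0 + 1 / L * u)) \<partial>lborel)"
    by (rule nn_integral_cmult[symmetric]) measurable
  also have "\<dots> = (\<integral>\<^sup>+ u. ennreal (A * L powr \<alpha> * ?w u) * indicator {c..C} u \<partial>lborel)"
  proof (rule nn_integral_cong)
    fix u :: real
    show "ennreal \<bar>1 / L\<bar> * (ennreal (A * ((0 + 1 / L * u) powr (- \<alpha> - d - 1) * \<bar>shell_multiplier k (0 + 1 / L * u) \<xi>\<bar>)) * indicator {c / L..C / L} (0 + 1 / L * u))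
      = ennreal (A * L powr \<alpha> * ?w u) * indicator {c..C} u"
    proof (cases "u \<in> {c..C}")
      case True
      then have "u > 0" using assms by simp
      have "1 / L * (u / L) powr (- \<alpha> - d - 1) * (1 / L) ^ DIM('a) = L powr \<alpha> * u powr (- \<alpha> - d - 1)"
      proof -
        have "L powr (\<alpha> + d + 1) = L powr \<alpha> * L ^ DIM('a) * L"
          using \<open>L > 0\<close> by (simp add: powr_add powr_realpow d_def)
        moreover have "L powr (- \<alpha> - d - 1) = 1 / L powr (\<alpha> + d + 1)"
          by (metis (no_types, opaque_lifting) diff_conv_add_uminus minus_add_distrib powr_minus_divide)
        ultimately show ?thesis
          using \<open>L > 0\<close> \<open>u > 0\<close> by (simp add: powr_divide power_divide)
      qed
      then have "1 / L * (A * ((u / L) powr (- \<alpha> - d - 1) * \<bar>shell_multiplier k (1 / L * u) \<xi>\<bar>)) = A * L powr \<alpha> * ?w u"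
        unfolding shell_multiplier_scale
        using \<open>L > 0\<close> by (simp add: abs_mult divide_inverse algebra_simps)
      then show ?thesis
        using True \<open>L > 0\<close> by (simp add: divide_right_mono flip: ennreal_mult')
    next
      case False
      then show ?thesis using \<open>L > 0\<close> by (auto simp: indicator_def field_simps)
    qed
  qed
  also have "\<dots> = ennreal (A * L powr \<alpha> * integral {c..C} ?w)"
  proof (rule nn_integral_has_integral_lebesgue')
    have "?w integrable_on {c..C}"
      using assms by (intro integrable_continuous_real continuous_intros continuous_on_shell_multiplier_radius) auto
    then show "((\<lambda>u. A * L powr \<alpha> * ?w u) has_integral (A * L powr \<alpha> * integral {c..C} ?w)) {c..C}"
      by (intro has_integral_mult_right integrable_integral)
  qed (use assms in auto)
  finally show ?thesis .
qed

text \<open>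
  The central estimate: the pointwise bound in \<open>r\<close> is integrated over the window of radii comparable to
  \<open>1 / norm \<xi>\<close>. The restriction \<open>1 \<le> norm \<xi>\<close> keeps these radii below \<open>C\<close>, so that the relevant
  centres stay in one ball.
\<close>

lemma Fourier_le_SBE_norm:
  fixes \<nu> :: "'a::euclidean_space measure" and \<xi> :: 'a and \<alpha> :: real
  assumes \<nu>: "finite_measure \<nu>" "sets \<nu> = sets borel" and supp: "emeasure \<nu> (- cball 0 R) = 0"
    and pq: "1 \<le> p" "1 \<le> q" and cC: "0 < c" "c < C" and \<xi>: "1 \<le> norm \<xi>"
  defines "k \<equiv> nat \<lceil>\<alpha> + real DIM('a) - 1\<rceil>"
  shows "ennreal (norm (\<integral>x. exp (\<i> * complex_of_real (\<xi> \<bullet> x)) \<partial>\<nu>) * norm \<xi> powr \<alpha> *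
      integral {c..C} (\<lambda>u. u powr (- \<alpha> - real DIM('a) - 1) * \<bar>shell_multiplier k u (\<xi> /\<^sub>R norm \<xi>)\<bar>))
    \<le> ennreal (C / c) * ((emeasure lborel (cball (0::'a) (R + C)) + 1) * SBE_norm \<alpha> p q (measure \<nu>))"
proof -
  define L where "L = norm \<xi>"
  have L: "L \<ge> 1" using \<xi> by (simp add: L_def)
  define A where "A = norm (\<integral>x. exp (\<i> * complex_of_real (\<xi> \<bullet> x)) \<partial>\<nu>)"
  define d where "d = real DIM('a)"
  define D where "D y r = Delta k (\<lambda>\<rho>. measure \<nu> (cball y \<rho>)) r" for y r
  define G where "G y r = ennreal \<bar>r powr (- \<alpha> - d) * D y r\<bar>" for y r
  define I where "I = {c / L..C / L}"
  define B where "B = cball (0::'a) (R + C)"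
  have D_meas: "(\<lambda>p. D (fst p) (snd p)) \<in> borel_measurable (borel \<Otimes>\<^sub>M borel)"
    using measurable_Delta_cball_mass[OF \<nu>, of k] by (simp add: D_def split_beta)
  then have G_meas: "(\<lambda>(y, r). G y r) \<in> borel_measurable (borel \<Otimes>\<^sub>M borel)"
    unfolding G_def split_beta by measurable
  have Dr: "(\<lambda>y. D y r) \<in> borel_measurable borel" for r
    using measurable_compose[of "\<lambda>y. (y, r)" borel, OF _ D_meas] by simp
  have pointwise: "ennreal (A * (r powr (- \<alpha> - d - 1) * \<bar>shell_multiplier k r \<xi>\<bar>)) * indicator I r \<le>
      (\<integral>\<^sup>+ y. ennreal (1 / r) * (G y r * indicator I r) * indicator B y \<partial>lborel)" for r
  proof (cases "r \<in> I")
    case True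
    have "c / L > 0" using cC L by simp
    moreover have "C / L \<le> C" using cC L by (simp add: divide_le_eq mult_le_cancel_left1)
    ultimately have r: "0 < r" "r \<le> C" using True unfolding I_def by auto
    have "ennreal (A * (r powr (- \<alpha> - d - 1) * \<bar>shell_multiplier k r \<xi>\<bar>)) =
        ennreal (r powr (- \<alpha> - d - 1)) * ennreal (A * \<bar>shell_multiplier k r \<xi>\<bar>)"
      by (subst ennreal_mult'[symmetric]) (simp_all add: mult_ac)
    also have "\<dots> \<le> ennreal (r powr (- \<alpha> - d - 1)) * (\<integral>\<^sup>+y. ennreal \<bar>D y r\<bar> \<partial>lborel)"
      unfolding A_def D_def
      by (intro mult_left_mono Fourier_times_shell_multiplier_le \<nu> r) simp
    also have "\<dots> = (\<integral>\<^sup>+y. ennreal (r powr (- \<alpha> - d - 1)) * ennreal \<bar>D y r\<bar> \<partial>lborel)"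
      using Dr[of r] by (intro nn_integral_cmult[symmetric]) simp
    also have "\<dots> = (\<integral>\<^sup>+ y. ennreal (1 / r) * (G y r * indicator I r) * indicator B y \<partial>lborel)"
    proof (rule nn_integral_cong)
      fix y :: 'a
      have "r powr (- \<alpha> - d - 1) = 1 / r * r powr (- \<alpha> - d)"
        using r by (simp add: powr_diff)
      then have "ennreal (r powr (- \<alpha> - d - 1)) * ennreal \<bar>D y r\<bar> = ennreal (1 / r) * G y r"
        using r by (simp add: G_def abs_mult mult.assoc flip: ennreal_mult'')
      moreover have "D y r = 0" if "y \<notin> B"
        using Delta_cball_mass_eq_0[OF \<nu>(2) supp r] that by (simp add: D_def B_def)
      ultimately show "ennreal (r powr (- \<alpha> - d - 1)) * ennreal \<bar>D y r\<bar> =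
          ennreal (1 / r) * (G y r * indicator I r) * indicator B y"
        using True by (auto simp: indicator_def)
    qed
    finally show ?thesis using True by simp
  qed simp
  have "ennreal (A * L powr \<alpha> * integral {c..C} (\<lambda>u. u powr (- \<alpha> - d - 1) * \<bar>shell_multiplier k u (\<xi> /\<^sub>R L)\<bar>)) =
      (\<integral>\<^sup>+ r. ennreal (A * (r powr (- \<alpha> - d - 1) * \<bar>shell_multiplier k r \<xi>\<bar>)) * indicator I r \<partial>lborel)"
    unfolding I_def L_def d_def
    using \<xi> cC by (intro nn_integral_shell_multiplier_scale[symmetric]) (auto simp: A_def)
  also have "\<dots> \<le> (\<integral>\<^sup>+ r. \<integral>\<^sup>+ y. ennreal (1 / r) * (G y r * indicator I r) * indicator B y \<partial>lborel \<partial>lborel)"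
    by (intro nn_integral_mono pointwise)
  also have "\<dots> \<le> ennreal (C / c) * ((emeasure lborel B + 1) * Lp_norm q lborel (\<lambda>y. Lp_norm p dr_over_r (G y)))"
    unfolding I_def using L cC pq
    by (intro iterated_integral_le_mixed_Lp_norm G_meas) (auto simp: B_def)
  also have "Lp_norm q lborel (\<lambda>y. Lp_norm p dr_over_r (G y)) = SBE_norm \<alpha> p q (measure \<nu>)"
    by (simp add: SBE_norm_def G_def[abs_def] D_def k_def d_def Let_def)
  finally show ?thesis by (simp add: A_def L_def d_def B_def)
qed

section \<open>Occupation measures and irregularity\<close>

lemma measurable_on_subinterval:
  fixes \<omega> :: "real \<Rightarrow> 'a::euclidean_space"
  assumes "\<omega> \<in> borel_measurable (lebesgue_on {a..b})" and "a \<le> s" "t \<le> b"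
  shows "\<omega> \<in> borel_measurable (lebesgue_on {s..t})"
  by (rule measurable_restrict_mono[OF assms(1)]) (use assms in auto)

lemma sets_occupation_measure: "sets (occupation_measure \<omega> s t) = sets borel"
  by (simp add: occupation_measure_def)

lemma finite_measure_occupation_measure:
  assumes "\<omega> \<in> borel_measurable (lebesgue_on {s..t})"
  shows "finite_measure (occupation_measure \<omega> s t)"
  unfolding occupation_measure_def
  by (rule finite_measure.finite_measure_distr[OF _ assms]) (simp add: finite_measure_lebesgue_on)

lemma occupation_time_in_sets_lebesgue:
  fixes \<omega> :: "real \<Rightarrow> 'a::euclidean_space"
  assumes "\<omega> \<in> borel_measurable (lebesgue_on {s..t})" and "A \<in> sets borel"
  shows "\<omega> -` A \<inter> {s..t} \<in> sets lebesgue"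
proof -
  have "{s..t} \<inter> space lebesgue \<in> sets lebesgue"
    using fmeasurableD[OF lmeasurable_interval(1)[of s t]] by simp
  then show ?thesis
    using measurable_sets[OF assms] by (simp add: sets_restrict_space_iff)
qed

lemma emeasure_occupation_measure:
  assumes "\<omega> \<in> borel_measurable (lebesgue_on {s..t})" and "A \<in> sets borel"
  shows "emeasure (occupation_measure \<omega> s t) A = emeasure lebesgue (\<omega> -` A \<inter> {s..t})"
  unfolding occupation_measure_def
  using assms by (simp add: emeasure_distr emeasure_restrict_space)

text \<open>
  The increment of the occupation measure is itself an occupation measure, hence nonnegative: the two
  time intervals overlap only in the null set \<open>{s}\<close>.
\<close>

lemma measure_occupation_measure_diff:
  assumes \<omega>: "\<omega> \<in> borel_measurable (lebesgue_on {a..t})" and st: "a \<le> s" "s \<le> t"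
    and A: "A \<in> sets borel"
  shows "measure (occupation_measure \<omega> s t) A =
    measure (occupation_measure \<omega> a t) A - measure (occupation_measure \<omega> a s) A"
proof -
  have \<omega>s: "\<omega> \<in> borel_measurable (lebesgue_on {a..s})" "\<omega> \<in> borel_measurable (lebesgue_on {s..t})"
    using measurable_on_subinterval[OF \<omega>] st by auto
  have "\<omega> -` A \<inter> {a..s} \<inter> (\<omega> -` A \<inter> {s..t}) \<in> null_sets lebesgue"
    by (rule null_sets_subset[of "{s}"])
       (use occupation_time_in_sets_lebesgue[OF _ A] \<omega>s in \<open>auto intro: null_sets_completionI\<close>)
  moreover have "\<omega> -` A \<inter> {a..t} = (\<omega> -` A \<inter> {a..s}) \<union> (\<omega> -` A \<inter> {s..t})"
    using st by auto
  ultimately have "emeasure (occupation_measure \<omega> a t) A =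
      emeasure (occupation_measure \<omega> a s) A + emeasure (occupation_measure \<omega> s t) A"
    using emeasure_Un'[OF occupation_time_in_sets_lebesgue[OF \<omega>s(1) A]
        occupation_time_in_sets_lebesgue[OF \<omega>s(2) A]]
    by (simp add: emeasure_occupation_measure[OF _ A] \<omega> \<omega>s)
  then have "ennreal (measure (occupation_measure \<omega> a t) A) =
      ennreal (measure (occupation_measure \<omega> a s) A + measure (occupation_measure \<omega> s t) A)"
    by (simp add: finite_measure.emeasure_eq_measure finite_measure_occupation_measure \<omega> \<omega>s)
  then show ?thesis by (simp del: ennreal_plus)
qed

lemma occupation_measure_Fourier:
  assumes "\<omega> \<in> borel_measurable (lebesgue_on {s..t})"
  shows "(LINT r|lebesgue_on {s..t}. exp (\<i> * complex_of_real (\<xi> \<bullet> \<omega> r))) =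
    (\<integral>x. exp (\<i> * complex_of_real (\<xi> \<bullet> x)) \<partial>occupation_measure \<omega> s t)"
  unfolding occupation_measure_def
  by (rule integral_distr[symmetric, OF assms]) (intro borel_measurable_continuous_onI continuous_intros)

lemma norm_path_Fourier_le:
  fixes \<omega> :: "real \<Rightarrow> 'a::euclidean_space"
  assumes "s \<le> t"
  shows "norm (LINT r|lebesgue_on {s..t}. exp (\<i> * complex_of_real (\<xi> \<bullet> \<omega> r))) \<le> t - s"
proof -
  have "norm (LINT r|lebesgue_on {s..t}. exp (\<i> * complex_of_real (\<xi> \<bullet> \<omega> r)))
      \<le> (LINT r|lebesgue_on {s..t}. norm (exp (\<i> * complex_of_real (\<xi> \<bullet> \<omega> r))))"
    by (rule integral_norm_bound)
  also have "\<dots> = t - s"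
    using assms by (simp add: measure_restrict_space)
  finally show ?thesis .
qed

theorem proposition3p1:
  fixes \<omega> :: "real \<Rightarrow> 'a::euclidean_space"
    and \<alpha> \<gamma> a b :: real
    and p q :: ennreal
  assumes "\<alpha> > 0" and "1 \<le> p" and "1 \<le> q" and "0 < \<gamma>" and "\<gamma> < 1" and "a \<le> b"
    and "\<omega> \<in> borel_measurable (lebesgue_on {a..b})"
    and "holder_in_SBE \<alpha> p q \<gamma> a b (\<lambda>t. occupation_measure \<omega> a t)"
  shows "irregular \<alpha> \<gamma> a b \<omega>"
proof -
  note \<omega> = assms(7)
  define k where "k = nat \<lceil>\<alpha> + real DIM('a) - 1\<rceil>"
  obtain H where H: "H \<ge> 0" "\<And>s t. s \<in> {a..b} \<Longrightarrow> t \<in> {a..b} \<Longrightarrow>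
      SBE_norm \<alpha> p q (\<lambda>A. measure (occupation_measure \<omega> a t) A - measure (occupation_measure \<omega> a s) A)
        \<le> ennreal (H * \<bar>t - s\<bar> powr \<gamma>)"
    using assms(8) unfolding holder_in_SBE_def by blast
  have "in_SBE \<alpha> p q (occupation_measure \<omega> a b)"
    using assms(6,8) by (simp add: holder_in_SBE_def)
  then obtain S where S: "compact S" "emeasure (occupation_measure \<omega> a b) (- S) = 0"
    unfolding in_SBE_def by blast
  obtain R where R: "S \<subseteq> cball 0 R"
    using compact_imp_bounded[OF S(1)] by (auto simp: bounded_iff subset_iff)
  obtain c C m where c: "0 < c" "c < C" and m: "0 < m" "\<And>e::'a. norm e = 1 \<Longrightarrow>
      m \<le> integral {c..C} (\<lambda>u. u powr (- \<alpha> - real DIM('a) - 1) * \<bar>shell_multiplier k u e\<bar>)"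
    by (rule shell_multiplier_integral_bounded_below[where 'a = 'a and k = k and \<beta> = "- \<alpha> - real DIM('a) - 1"])
       (rule that)
  define V where "V = measure lborel (cball (0::'a) (R + C))"
  have V: "emeasure lborel (cball (0::'a) (R + C)) = ennreal V" "V \<ge> 0"
    using emeasure_lborel_cball_finite[of "0::'a" "R + C"]
    by (auto simp: V_def intro!: emeasure_eq_ennreal_measure)
  define Q where "Q = C / c * ((V + 1) * H) / m"
  have Q: "Q \<ge> 0" using c m(1) V(2) H(1) by (simp add: Q_def)
  define Z where "Z = (b - a) powr (1 - \<gamma>) + Q"
  have Z: "Q \<le> Z" "(b - a) powr (1 - \<gamma>) \<le> Z" "Z \<ge> 0"
    using Q by (simp_all add: Z_def)
  \<comment> \<open>The scale \<open>(1 + norm \<xi>) / 2\<close> is at most \<open>1\<close> if \<open>norm \<xi> \<le> 1\<close> and at most \<open>norm \<xi>\<close> otherwise, so its negative power dominates both bounds below.\<close>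
  have half_scale: "2 powr \<alpha> * (1 + norm \<xi>) powr (- \<alpha>) = ((1 + norm \<xi>) / 2) powr (- \<alpha>)" for \<xi> :: 'a
  proof -
    have "((1 + norm \<xi>) / 2) powr (- \<alpha>) = (1 + norm \<xi>) powr (- \<alpha>) / 2 powr (- \<alpha>)"
      by (rule powr_divide)
    moreover have "2 powr (- \<alpha>) = inverse (2 powr \<alpha>)"
      by (rule powr_minus)
    ultimately show ?thesis
      by (simp only: divide_inverse inverse_inverse_eq mult.commute)
  qed
  have main: "norm (LINT r|lebesgue_on {s..t}. exp (\<i> * complex_of_real (\<xi> \<bullet> \<omega> r)))
      \<le> Z * 2 powr \<alpha> * (1 + norm \<xi>) powr (- \<alpha>) * \<bar>t - s\<bar> powr \<gamma>"
    if st: "a \<le> s" "s \<le> t" "t \<le> b" for \<xi> :: 'a and s t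
  proof (cases "norm \<xi> \<ge> 1")
    case False
    have "t - s = \<bar>t - s\<bar> powr (1 - \<gamma>) * \<bar>t - s\<bar> powr \<gamma>"
      using st by (simp flip: powr_add)
    also have "\<dots> \<le> (b - a) powr (1 - \<gamma>) * \<bar>t - s\<bar> powr \<gamma>"
      using st \<open>\<gamma> < 1\<close> by (intro mult_right_mono powr_mono2) auto
    also have "\<dots> \<le> Z * \<bar>t - s\<bar> powr \<gamma>"
      by (intro mult_right_mono Z) auto
    also have "\<dots> \<le> Z * ((1 + norm \<xi>) / 2) powr (- \<alpha>) * \<bar>t - s\<bar> powr \<gamma>"
    proof (intro mult_right_mono)
      have "1 powr (- \<alpha>) \<le> ((1 + norm \<xi>) / 2) powr (- \<alpha>)"
        using False \<open>\<alpha> > 0\<close> by (intro powr_mono2') (auto simp: add_pos_nonneg)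
      then show "Z \<le> Z * ((1 + norm \<xi>) / 2) powr (- \<alpha>)"
        using Z(3) by (simp add: mult_le_cancel_left1)
    qed simp
    finally show ?thesis
      using norm_path_Fourier_le[OF \<open>s \<le> t\<close>, of \<xi> \<omega>] by (simp flip: half_scale)
  next
    case True
    define \<nu> where "\<nu> = occupation_measure \<omega> s t"
    define F where "F = norm (\<integral>x. exp (\<i> * complex_of_real (\<xi> \<bullet> x)) \<partial>\<nu>)"
    define J where "J = integral {c..C} (\<lambda>u. u powr (- \<alpha> - real DIM('a) - 1) *
      \<bar>shell_multiplier k u (\<xi> /\<^sub>R norm \<xi>)\<bar>)"
    have \<omega>st: "\<omega> \<in> borel_measurable (lebesgue_on {s..t})" "\<omega> \<in> borel_measurable (lebesgue_on {a..t})"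
      using measurable_on_subinterval[OF \<omega>] st by auto
    have supp: "emeasure \<nu> (- cball 0 R) = 0"
    proof -
      have "emeasure \<nu> (- cball 0 R) = emeasure lebesgue (\<omega> -` (- cball 0 R) \<inter> {s..t})"
        unfolding \<nu>_def by (rule emeasure_occupation_measure[OF \<omega>st(1)]) simp
      also have "\<dots> \<le> emeasure lebesgue (\<omega> -` (- S) \<inter> {a..b})"
        using st R compact_imp_closed[OF S(1)]
        by (intro emeasure_mono occupation_time_in_sets_lebesgue[OF \<omega>]) auto
      also have "\<dots> = emeasure (occupation_measure \<omega> a b) (- S)"
        using compact_imp_closed[OF S(1)] by (intro emeasure_occupation_measure[OF \<omega>, symmetric]) auto
      finally show ?thesis using S(2) by simp
    qed
    have "SBE_norm \<alpha> p q (measure \<nu>) =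
        SBE_norm \<alpha> p q (\<lambda>A. measure (occupation_measure \<omega> a t) A - measure (occupation_measure \<omega> a s) A)"
      using measure_occupation_measure_diff[OF \<omega>st(2) st(1,2)]
      by (simp add: SBE_norm_def \<nu>_def)
    also have "\<dots> \<le> ennreal (H * \<bar>t - s\<bar> powr \<gamma>)"
      using st by (intro H(2)) auto
    finally have SBE: "SBE_norm \<alpha> p q (measure \<nu>) \<le> ennreal (H * \<bar>t - s\<bar> powr \<gamma>)" .
    have "ennreal (F * norm \<xi> powr \<alpha> * J) \<le>
        ennreal (C / c) * ((emeasure lborel (cball (0::'a) (R + C)) + 1) * SBE_norm \<alpha> p q (measure \<nu>))"
      unfolding F_def J_def k_def
      by (rule Fourier_le_SBE_norm)
         (use supp assms c True \<omega>st in
           \<open>auto simp: \<nu>_def sets_occupation_measure finite_measure_occupation_measure\<close>)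
    also have "\<dots> \<le> ennreal (C / c) * (ennreal (V + 1) * ennreal (H * \<bar>t - s\<bar> powr \<gamma>))"
      using V by (intro mult_left_mono mult_mono SBE) auto
    also have "\<dots> = ennreal (C / c * ((V + 1) * (H * \<bar>t - s\<bar> powr \<gamma>)))"
      using V(2) H(1) c by (simp del: ennreal_plus flip: ennreal_mult)
    finally have "F * norm \<xi> powr \<alpha> * J \<le> C / c * ((V + 1) * (H * \<bar>t - s\<bar> powr \<gamma>))"
      using V(2) H(1) c by (subst (asm) ennreal_le_iff) auto
    also have "\<dots> = Q * \<bar>t - s\<bar> powr \<gamma> * m"
      using m(1) by (simp add: Q_def)
    finally have "F * norm \<xi> powr \<alpha> * J \<le> Q * \<bar>t - s\<bar> powr \<gamma> * m" .
    moreover have "norm (\<xi> /\<^sub>R norm \<xi>) = 1"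
      using True by (cases "\<xi> = 0") auto
    then have "m \<le> J"
      unfolding J_def by (rule m(2))
    then have "F * norm \<xi> powr \<alpha> * m \<le> F * norm \<xi> powr \<alpha> * J"
      by (intro mult_left_mono) (auto simp: F_def)
    ultimately have "F * norm \<xi> powr \<alpha> * m \<le> Q * \<bar>t - s\<bar> powr \<gamma> * m"
      by linarith
    then have "F * norm \<xi> powr \<alpha> \<le> Q * \<bar>t - s\<bar> powr \<gamma>"
      using m(1) by simp
    moreover have "norm \<xi> powr \<alpha> > 0"
      using True by (subst powr_gt_zero) linarith
    ultimately have "F \<le> Q * \<bar>t - s\<bar> powr \<gamma> * norm \<xi> powr (- \<alpha>)"
      by (simp add: powr_minus_divide pos_le_divide_eq)
    also have "\<dots> \<le> Z * \<bar>t - s\<bar> powr \<gamma> * ((1 + norm \<xi>) / 2) powr (- \<alpha>)"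
    proof (intro mult_mono)
      show "norm \<xi> powr (- \<alpha>) \<le> ((1 + norm \<xi>) / 2) powr (- \<alpha>)"
        using True \<open>\<alpha> > 0\<close> by (intro powr_mono2') auto
    qed (use Z Q in auto)
    finally show ?thesis
      using occupation_measure_Fourier[OF \<omega>st(1), of \<xi>]
      by (simp add: F_def \<nu>_def mult_ac flip: half_scale)
  qed
  show ?thesis
    unfolding irregular_def using main by blast
qed

end
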